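(* Let $\mathrm{G}=\{\mathcal N, J_i,\mathbb R\}$ be an $N$-player noncooperative game ($N\ge 2$) and let $\mathcal G$ be a weighted digraph on $\mathcal N=\{1,\dots,N\}$ with Laplacian $L$. Suppose that: (1) for each $i\in\mathcal N$, $J_i(z_i,\boldsymbol z_{-i})$ is twice continuously differentiable, and strictly convex and radially unbounded in $z_i\in\mathbb R$ for any fixed $\boldsymbol z_{-i}\in\mathbb R^{N-1}$; (2) the pseudogradient $F:\mathbb R^N\to\mathbb R^N$ is $\underline l$-strongly monotone and $\bar l$-Lipschitz for constants $\underline l,\bar l>0$; (3) the extended pseudogradient $\boldsymbol F:\mathbb R^{N^2}\to\mathbb R^N$ is $l_F$-Lipschitz with $l_F>0$; (4) $\mathcal G$ is strongly connected. Let $l=\max\{\bar l,l_F\}$, let $\xi=\mathrm{col}(\xi_1,\dots,\xi_N)$ be the left eigenvector of $L$ with $\xi^\top L=0$ and $\xi^\top\mathbf 1=1$, let $\Lambda=\mathrm{diag}(\xi_1,\dots,\xi_N)$, let $\lambda_2'$ be the smallest positive eigenvalue of $\mathrm{Sym}(\Lambda L)=\frac{\Lambda L+(\Lambda L)^\top}{2}$, and let $\alpha>\frac{1}{\lambda_2'}\left(\frac{l^2}{\underline l}+l\right)$. Consider the system $$\dot{\mathbf z}^i=-\alpha\,\xi^i_i\sum_{j=1}^N a_{ij}(\mathbf z^i-\mathbf z^j)-R_i\nabla_iJ_i(\mathbf z^i),\qquad \dot{\boldsymbol\xi}^i=-\sum_{j=1}^N a_{ij}(\boldsymbol\xi^i-\boldsymbol\xi^j),\qquad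 i\in\mathcal N,$$ with $\mathbf z^i\in\mathbb R^N$, $\boldsymbol\xi^i=\mathrm{col}(\xi^i_1,\dots,\xi^i_N)\in\mathbb R^N$, initial values $\xi^i_i(0)=1$ and $\xi^i_j(0)=0$ for all $j\ne i$, and arbitrary $\mathbf z^i(0)$. Then, for any $i\in\mathcal N$, along any trajectory of this system, $\mathbf z^i(t)$ converges exponentially to the Nash equilibrium $z^*$ of $\mathrm G$ as $t\to+\infty$.
   Context: Game. Player $i\in\mathcal N=\{1,\dots,N\}$ has decision $z_i\in\mathbb R$ and a cost function $J_i(z_i,\boldsymbol z_{-i})$, where $\boldsymbol z_{-i}\in\mathbb R^{N-1}$ collects the decisions of all other players; $z=\mathrm{col}(z_1,\dots,z_N)$, where $\mathrm{col}$ denotes stacking of column vectors. A Nash equilibrium is $z^*=\mathrm{col}(z_1^*,\dots,z_N^* )$ with $J_i(z_i^*,\boldsymbol z_{-i}^* )\le J_i(z_i,\boldsymbol z_{-i}^* )$ for all $i\in\mathcal N$ and $z_i\in\mathbb R$. Under hypotheses (1) and (2) the game has a unique Nash equilibrium $z^*$, characterized by $F(z^* )=0$. Write $\nabla_iJ_i(z)=\frac{\partial J_i}{\partial z_i}(z_i,\boldsymbol z_{-i})\in\mathbb R$. The pseudogradient is $F(z)=\mathrm{col}(\nabla_1J_1(z),\dots,\nabla_NJ_N(z))$ for $z\in\mathbb R^N$. For $\mathbf z=\mathrm{col}(\mathbf z^1,\dots,\mathbf z^N)$ with $\mathbf z^i=\mathrm{col}(z^i_1,\dots,z^i_N)\in\mathbb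 R^N$ (player $i$'s estimate of all players' decisions, with $z_i^i=z_i$), $\nabla_iJ_i(\mathbf z^i)$ is the same partial derivative evaluated at $\mathbf z^i$, and the extended pseudogradient is $\boldsymbol F(\mathbf z)=\mathrm{col}(\nabla_1J_1(\mathbf z^1),\dots,\nabla_NJ_N(\mathbf z^N))\in\mathbb R^N$. $R_i\in\mathbb R^N$ is the $i$-th standard basis vector. $\Phi:\mathbb R^m\to\mathbb R^m$ is $\omega$-strongly monotone if $(\zeta_1-\zeta_2)^\top[\Phi(\zeta_1)-\Phi(\zeta_2)]\ge\omega\|\zeta_1-\zeta_2\|^2$ for all $\zeta_1,\zeta_2$; a map $\Phi$ is $\vartheta$-Lipschitz if $\|\Phi(\zeta_1)-\Phi(\zeta_2)\|\le\vartheta\|\zeta_1-\zeta_2\|$ for all $\zeta_1,\zeta_2$ (Euclidean norms). Graph. A weighted digraph $\mathcal G=(\mathcal N,\mathcal E,\mathcal A)$ has adjacency matrix $\mathcal A=[a_{ij}]\in\mathbb R^{N\times N}$ with $a_{ii}=0$, $a_{ij}\ge0$, and $a_{ij}>0$ iff there is an edge $(j,i)\in\mathcal E$ from $j$ to $i$. It is strongly connected if there is a directed path between any two nodes (in each direction). The Laplacian is $L=D^{\mathrm{in}}-\mathcal A$ with $D^{\mathrm{in}}=\mathrm{diag}(\sum_ja_{1j},\dots,\sum_ja_{Nj})$. For a strongly connected digraph, the eigenvalue $0$ of $L$ is simple and the normalized left eigenvector $\xi$ is unique and componentwise positive; $\Lambda L$ is then the Laplacian of the strongly connected weight-balanced digraph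 with weights $a'_{ij}=\xi_ia_{ij}$ (weight-balanced meaning $\sum_ja'_{ij}=\sum_ja'_{ji}$ for all $i$), so $\mathrm{Sym}(\Lambda L)$ is positive semidefinite with simple eigenvalue $0$. Exponential convergence of $x(t)$ to $x^*$ means there are constants $c,\beta>0$ with $\|x(t)-x^*\|\le c\,e^{-\beta t}$ for all $t\ge0$. *)

theory Defs
  imports "HOL-Analysis.Analysis"
begin

text \<open>
  The player set is a finite type \<open>'n\<close>. A decision profile is a vector in \<open>real ^ 'n\<close>, and
  \<open>J i z\<close> stands for \<open>J\<^sub>i(z\<^sub>i, z\<^sub>-\<^sub>i)\<close>. A family of \<open>'n\<close>-vectors, one for each player, is an element
  of \<open>(real ^ 'n) ^ 'n\<close>, whose \<open>i\<close>-th component is player \<open>i\<close>'s vector; the norm of this type is the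
  Euclidean norm of the stacked vector.
\<close>

definition replace :: "real ^ 'n \<Rightarrow> 'n \<Rightarrow> real \<Rightarrow> real ^ 'n" where
  "replace z i s = (\<chi> j. if j = i then s else z $ j)"

definition nash_equilibrium :: "('n \<Rightarrow> real ^ 'n \<Rightarrow> real) \<Rightarrow> real ^ 'n \<Rightarrow> bool" where
  "nash_equilibrium J z \<longleftrightarrow> (\<forall>i s. J i z \<le> J i (replace z i s))"

definition partial_grad :: "('n \<Rightarrow> real ^ 'n \<Rightarrow> real) \<Rightarrow> 'n \<Rightarrow> real ^ 'n \<Rightarrow> real" where
  "partial_grad J i z = deriv (\<lambda>s. J i (replace z i s)) (z $ i)"

definition pseudogradient :: "('n \<Rightarrow> real ^ 'n \<Rightarrow> real) \<Rightarrow> real ^ 'n \<Rightarrow> real ^ 'n" where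
  "pseudogradient J z = (\<chi> i. partial_grad J i z)"

definition extended_pseudogradient ::
    "('n \<Rightarrow> real ^ 'n \<Rightarrow> real) \<Rightarrow> (real ^ 'n) ^ 'n \<Rightarrow> real ^ 'n" where
  "extended_pseudogradient J z = (\<chi> i. partial_grad J i (z $ i))"

definition twice_continuously_differentiable :: "('a::real_normed_vector \<Rightarrow> real) \<Rightarrow> bool" where
  "twice_continuously_differentiable f \<longleftrightarrow>
     (\<exists>(f' :: 'a \<Rightarrow> 'a \<Rightarrow>\<^sub>L real) (f'' :: 'a \<Rightarrow> 'a \<Rightarrow>\<^sub>L ('a \<Rightarrow>\<^sub>L real)).
        (\<forall>x. (f has_derivative blinfun_apply (f' x)) (at x)) \<and>
        (\<forall>x. (f' has_derivative blinfun_apply (f'' x)) (at x)) \<and>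
        continuous_on UNIV f'')"

definition strictly_convex :: "('a::real_vector \<Rightarrow> real) \<Rightarrow> bool" where
  "strictly_convex f \<longleftrightarrow>
     (\<forall>x y u. x \<noteq> y \<and> 0 < u \<and> u < 1 \<longrightarrow>
        f ((1 - u) *\<^sub>R x + u *\<^sub>R y) < (1 - u) * f x + u * f y)"

definition radially_unbounded :: "('a::real_normed_vector \<Rightarrow> real) \<Rightarrow> bool" where
  "radially_unbounded f \<longleftrightarrow> filterlim f at_top at_infinity"

definition strongly_monotone :: "real \<Rightarrow> ('a::real_inner \<Rightarrow> 'a) \<Rightarrow> bool" where
  "strongly_monotone \<omega> \<Phi> \<longleftrightarrow> (\<forall>x y. (x - y) \<bullet> (\<Phi> x - \<Phi> y) \<ge> \<omega> * (norm (x - y))\<^sup>2)"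

text \<open>A weighted digraph is given by its adjacency matrix; \<open>A $ i $ j > 0\<close> is an edge from \<open>j\<close> to \<open>i\<close>.\<close>

definition weighted_digraph :: "real ^ 'n ^ 'n \<Rightarrow> bool" where
  "weighted_digraph A \<longleftrightarrow> (\<forall>i. A $ i $ i = 0) \<and> (\<forall>i j. A $ i $ j \<ge> 0)"

definition edges :: "real ^ 'n ^ 'n \<Rightarrow> ('n \<times> 'n) set" where
  "edges A = {(j, i). A $ i $ j > 0}"

definition strongly_connected_digraph :: "real ^ 'n ^ 'n \<Rightarrow> bool" where
  "strongly_connected_digraph A \<longleftrightarrow> (\<forall>i j. (i, j) \<in> (edges A)\<^sup>*)"

definition diag :: "real ^ 'n \<Rightarrow> real ^ 'n ^ 'n" where
  "diag v = (\<chi> i j. if i = j then v $ i else 0)"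

definition laplacian :: "real ^ 'n ^ 'n \<Rightarrow> real ^ 'n ^ 'n" where
  "laplacian A = diag (\<chi> i. \<Sum>j\<in>UNIV. A $ i $ j) - A"

definition Sym :: "real ^ 'n ^ 'n \<Rightarrow> real ^ 'n ^ 'n" where
  "Sym M = (1 / 2) *\<^sub>R (M + transpose M)"

definition eigenvalue :: "real ^ 'n ^ 'n \<Rightarrow> real \<Rightarrow> bool" where
  "eigenvalue M \<mu> \<longleftrightarrow> (\<exists>v. v \<noteq> 0 \<and> M *v v = \<mu> *\<^sub>R v)"

definition smallest_pos_eigenvalue :: "real ^ 'n ^ 'n \<Rightarrow> real" where
  "smallest_pos_eigenvalue M = (LEAST \<mu>. \<mu> > 0 \<and> eigenvalue M \<mu>)"

text \<open>\<open>z t $ i\<close> is \<open>\<^bold>z\<^sup>i(t)\<close> and \<open>\<Xi> t $ i $ j\<close> is \<open>\<xi>\<^sup>i\<^sub>j(t)\<close>; at \<open>t = 0\<close> the derivative is one-sided.\<close>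

definition is_trajectory ::
    "('n \<Rightarrow> real ^ 'n \<Rightarrow> real) \<Rightarrow> real ^ 'n ^ 'n \<Rightarrow> real \<Rightarrow>
     (real \<Rightarrow> (real ^ 'n) ^ 'n) \<Rightarrow> (real \<Rightarrow> (real ^ 'n) ^ 'n) \<Rightarrow> bool" where
  "is_trajectory J A \<alpha> z \<Xi> \<longleftrightarrow>
     (\<forall>i. \<forall>t\<ge>0.
        ((\<lambda>t. z t $ i) has_vector_derivative
           (- (\<alpha> * \<Xi> t $ i $ i) *\<^sub>R (\<Sum>j\<in>UNIV. A $ i $ j *\<^sub>R (z t $ i - z t $ j))
            - partial_grad J i (z t $ i) *\<^sub>R axis i 1)) (at t within {0..})) \<and>
     (\<forall>i. \<forall>t\<ge>0.
        ((\<lambda>t. \<Xi> t $ i) has_vector_derivative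
           (- (\<Sum>j\<in>UNIV. A $ i $ j *\<^sub>R (\<Xi> t $ i - \<Xi> t $ j)))) (at t within {0..})) \<and>
     (\<forall>i j. \<Xi> 0 $ i $ j = (if j = i then 1 else 0))"

definition converges_exponentially :: "(real \<Rightarrow> 'a::real_normed_vector) \<Rightarrow> 'a \<Rightarrow> bool" where
  "converges_exponentially x x0 \<longleftrightarrow>
     (\<exists>c \<beta>. c > 0 \<and> \<beta> > 0 \<and> (\<forall>t\<ge>0. norm (x t - x0) \<le> c * exp (- \<beta> * t)))"

end

theory Submission
  imports Defs
begin

text \<open>
  Nash equilibria are the zeros of the pseudogradient, and a strongly monotone Lipschitz map has
  exactly one zero by Banach's fixed point theorem. For the dynamics let \<open>e\<close> be the stacked
  estimation error, split into its mean over the players and the deviation from it, of norms \<open>a\<close>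
  and \<open>d\<close>. If every \<open>\<xi>\<^sup>i\<^sub>i\<close> were equal to \<open>\<xi>\<^sub>i\<close>, half the derivative of \<open>\<parallel>e\<parallel>\<^sup>2\<close> would be at most minus
  \<open>l_low a\<^sup>2 - 2 l a d + (\<alpha> \<lambda>\<^sub>2' - l) d\<^sup>2\<close>, and the bound on \<open>\<alpha>\<close> says exactly that this form is positive
  definite. Since \<open>\<xi>\<^sup>i\<^sub>i\<close> tends to \<open>\<xi>\<^sub>i\<close> exponentially (with Lyapunov function \<open>\<Sum>\<^sub>i \<xi>\<^sub>i w\<^sub>i\<^sup>2\<close> on the
  invariant hyperplane \<open>\<xi>\<^sup>T w = 0\<close>), the error made is an integrable multiple of \<open>\<parallel>e\<parallel>\<^sup>2\<close>, which
  Gronwall's inequality absorbs into the constant.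
\<close>

section \<open>A perturbed Gronwall estimate and quadratic forms in two variables\<close>

text \<open>Multiplying \<open>V\<close> by the integrating factor
  \<open>exp (c * s + K / \<beta> * exp (- \<beta> * s))\<close> gives a nonincreasing function. The
  perturbation \<open>K * exp (- \<beta> * s)\<close> has total integral \<open>K / \<beta>\<close>,
  so it costs the constant factor \<open>exp (K / \<beta>)\<close> and nothing of the rate
  \<open>c\<close>.\<close>

lemma exp_decay_of_differential_inequality:
  fixes V :: "real \<Rightarrow> real"
  assumes deriv: "\<And>t. 0 \<le> t \<Longrightarrow> (V has_real_derivative V' t) (at t within {0..})"
    and le: "\<And>t. 0 \<le> t \<Longrightarrow> V' t \<le> - (c - K * exp (- \<beta> * t)) * V t"
    and nonneg: "\<And>t. 0 \<le> t \<Longrightarrow> 0 \<le> V t"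
    and "0 \<le> K" "0 < \<beta>" "0 \<le> t"
  shows "V t \<le> V 0 * exp (K / \<beta>) * exp (- c * t)"
proof -
  define U where "U s = V s * exp (c * s + K / \<beta> * exp (- \<beta> * s))" for s
  have U': "(U has_real_derivative
      (V' s + (c - K * exp (- \<beta> * s)) * V s) * exp (c * s + K / \<beta> * exp (- \<beta> * s)))
      (at s within {0..})" if "0 \<le> s" for s
    unfolding U_def
    by (rule derivative_eq_intros deriv[OF that] refl)+ (use \<open>0 < \<beta>\<close> in \<open>simp add: algebra_simps\<close>)
  have "U t \<le> U 0"
  proof (rule DERIV_nonpos_imp_decreasing_open[OF \<open>0 \<le> t\<close>])
    fix s assume s: "0 < s" "s < t"
    \<comment> \<open>In the interior the one-sided derivative is two-sided; at the endpoint 0 the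
      monotonicity criterion asks only for continuity.\<close>
    then have "at s within {0..} = at s"
      by (intro at_within_interior) (simp add: interior_real_atLeast)
    then have "(U has_real_derivative
      (V' s + (c - K * exp (- \<beta> * s)) * V s) * exp (c * s + K / \<beta> * exp (- \<beta> * s))) (at s)"
      using U'[of s] s by simp
    moreover have "(V' s + (c - K * exp (- \<beta> * s)) * V s) * exp (c * s + K / \<beta> * exp (- \<beta> * s)) \<le> 0"
      using le[of s] s by (intro mult_nonpos_nonneg) (auto simp: algebra_simps)
    ultimately show "\<exists>y. (U has_real_derivative y) (at s) \<and> y \<le> 0" by blast
  next
    have "continuous_on {0..} U"
      using U' by (auto simp: continuous_on_eq_continuous_within intro: DERIV_continuous)
    then show "continuous_on {0..t} U" by (rule continuous_on_subset) auto
  qed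
  then have *: "U t \<le> V 0 * exp (K / \<beta>)" by (simp add: U_def)
  have "1 \<le> exp (K / \<beta> * exp (- \<beta> * t))"
    using assms by simp
  then have "V t * exp (c * t) \<le> V t * exp (c * t) * exp (K / \<beta> * exp (- \<beta> * t))"
    using nonneg[OF \<open>0 \<le> t\<close>] mult_left_mono[of 1 _ "V t * exp (c * t)"] by simp
  also have "\<dots> = U t" by (simp add: U_def exp_add)
  finally have "V t * exp (c * t) \<le> V 0 * exp (K / \<beta>)" using * by simp
  then have "V t * exp (c * t) * exp (- c * t) \<le> V 0 * exp (K / \<beta>) * exp (- c * t)"
    by (rule mult_right_mono) simp
  then show ?thesis by (simp add: mult.assoc exp_add[symmetric])
qed

lemma binary_quadratic_form_coercive:
  fixes p q r :: real
  assumes "0 < p" "r\<^sup>2 < p * q"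
  shows "\<exists>c>0. \<forall>a d. c * (a\<^sup>2 + d\<^sup>2) \<le> p * a\<^sup>2 - 2 * r * a * d + q * d\<^sup>2"
proof -
  have "0 < p * q" using assms(2) zero_le_power2[of r] by linarith
  then have q: "0 < q" using \<open>0 < p\<close> zero_less_mult_pos by blast
  \<comment> \<open>Determinant over trace of the matrix of the form: the determinant is the product
    of the eigenvalues and the trace exceeds the larger one, so the quotient lies below the smaller
    one.\<close>
  define c where "c = (p * q - r\<^sup>2) / (p + q)"
  have c: "c > 0" unfolding c_def using assms q by simp
  have cpq: "c * (p + q) = p * q - r\<^sup>2" unfolding c_def using assms q by simp
  have "c * (p + q) < p * (p + q)"
    using cpq mult_pos_pos[OF \<open>0 < p\<close> \<open>0 < p\<close>] zero_le_power2[of r]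
    unfolding distrib_left by linarith
  then have P: "p - c > 0" using assms q by simp
  have "c * (a\<^sup>2 + d\<^sup>2) \<le> p * a\<^sup>2 - 2 * r * a * d + q * d\<^sup>2" for a d
  proof -
    \<comment> \<open>Square completion for the form shifted by \<open>c\<close>. The coefficient of
      \<open>d\<^sup>2\<close> is the determinant of the shifted matrix, which \<open>cpq\<close>
      collapses to \<open>c\<^sup>2\<close>.\<close>
    have "(p - c) * (p * a\<^sup>2 - 2 * r * a * d + q * d\<^sup>2 - c * (a\<^sup>2 + d\<^sup>2))
        = ((p - c) * a - r * d)\<^sup>2 + (p * q - r\<^sup>2 - c * (p + q) + c\<^sup>2) * d\<^sup>2"
      by (simp add: power2_eq_square algebra_simps)
    also have "\<dots> = ((p - c) * a - r * d)\<^sup>2 + c\<^sup>2 * d\<^sup>2" by (simp add: cpq)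
    also have "\<dots> \<ge> 0" by simp
    finally show ?thesis using P by (simp add: zero_le_mult_iff)
  qed
  then show ?thesis using c by blast
qed

section \<open>Symmetric matrices, Laplacians and the Rayleigh quotient\<close>

lemma inner_symmetric_matrix:
  fixes M :: "real ^ 'n ^ 'n"
  assumes "transpose M = M"
  shows "(M *v x) \<bullet> y = x \<bullet> (M *v y)"
  by (metis assms dot_lmul_matrix transpose_matrix_vector)

lemma transpose_Sym: "transpose (Sym M) = Sym M"
  by (simp add: Sym_def transpose_def vec_eq_iff)

lemma inner_Sym: "x \<bullet> (Sym M *v x) = x \<bullet> (M *v x)"
proof -
  have "x \<bullet> (transpose M *v x) = x \<bullet> (M *v x)"
    by (metis dot_lmul_matrix inner_commute transpose_matrix_vector)
  then show ?thesis
    by (simp add: Sym_def scaleR_matrix_vector_assoc[symmetric] matrix_vector_mult_add_rdistrib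
        inner_add_right)
qed

lemma diag_mult_vec: "(diag v *v x) $ i = v $ i * x $ i"
proof -
  have "(diag v *v x) $ i = (\<Sum>j\<in>UNIV. if i = j then v $ i * x $ j else 0)"
    unfolding diag_def matrix_vector_mult_def by (simp add: if_distrib if_distribR cong: if_cong)
  then show ?thesis by simp
qed

lemma vec_mult_diag: "(x v* diag v) $ i = x $ i * v $ i"
proof -
  have "(x v* diag v) $ i = (\<Sum>j\<in>UNIV. if j = i then x $ j * v $ j else 0)"
    unfolding diag_def vector_matrix_mult_def vec_lambda_beta
    by (rule sum.cong) auto
  then show ?thesis by simp
qed

lemma laplacian_mult_vec:
  "(laplacian A *v x) $ i = (\<Sum>j\<in>UNIV. A $ i $ j * (x $ i - x $ j))"
  by (simp add: laplacian_def matrix_vector_mult_diff_rdistrib diag_mult_vec)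
    (simp add: matrix_vector_mult_def sum_subtractf right_diff_distrib sum_distrib_right)

lemma vec_mult_laplacian:
  "(x v* laplacian A) $ j = x $ j * (\<Sum>k\<in>UNIV. A $ j $ k) - (\<Sum>i\<in>UNIV. x $ i * A $ i $ j)"
proof -
  have "x v* laplacian A = x v* diag (\<chi> i. \<Sum>j\<in>UNIV. A $ i $ j) - x v* A"
    unfolding laplacian_def
    by (simp add: vector_matrix_mult_def vec_eq_iff right_diff_distrib left_diff_distrib sum_subtractf)
  then show ?thesis by (simp add: vec_mult_diag) (simp add: vector_matrix_mult_def mult.commute)
qed

lemma diag_matrix_mult_vec: "((diag v ** M) *v x) $ i = v $ i * (M *v x) $ i"
  by (simp add: matrix_vector_mul_assoc[symmetric] diag_mult_vec)

text \<open>The minimum of the quadratic form over the unit sphere of the orthogonal complement of \<open>u\<close> is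
  attained at an eigenvector.\<close>

lemma smallest_pos_eigenvalue_rayleigh:
  fixes M :: "real ^ 'n ^ 'n"
  assumes sym: "transpose M = M"
    and ker: "M *v u = 0"
    and pos: "\<And>x. x \<bullet> u = 0 \<Longrightarrow> x \<noteq> 0 \<Longrightarrow> 0 < x \<bullet> (M *v x)"
    and ne: "\<exists>x. x \<noteq> 0 \<and> x \<bullet> u = 0"
  shows "0 < smallest_pos_eigenvalue M"
    and "x \<bullet> u = 0 \<Longrightarrow> smallest_pos_eigenvalue M * (norm x)\<^sup>2 \<le> x \<bullet> (M *v x)"
proof -
  note inner_M = inner_symmetric_matrix[OF sym]
  define S where "S = sphere 0 1 \<inter> {x. u \<bullet> x = 0}"
  have "compact S"
    unfolding S_def by (intro compact_Int_closed compact_sphere closed_hyperplane)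
  moreover obtain x0 where x0: "x0 \<noteq> 0" "x0 \<bullet> u = 0" using ne by blast
  then have "(1 / norm x0) *\<^sub>R x0 \<in> S"
    by (simp add: S_def inner_commute)
  then have "S \<noteq> {}" by blast
  moreover have "continuous_on S (\<lambda>x. x \<bullet> (M *v x))"
    by (intro continuous_intros matrix_vector_mult_linear_continuous_on
        linear_continuous_on matrix_vector_mul_bounded_linear)
  ultimately obtain v where v: "v \<in> S" and vmin: "\<And>y. y \<in> S \<Longrightarrow> v \<bullet> (M *v v) \<le> y \<bullet> (M *v y)"
    using continuous_attains_inf by metis
  define m where "m = v \<bullet> (M *v v)"
  have vu: "v \<bullet> u = 0" and nv: "norm v = 1" using v by (auto simp: S_def inner_commute)
  then have v0: "v \<noteq> 0" by auto
  have m: "m > 0" unfolding m_def using pos[OF vu v0] .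
  have bound: "m * (norm x)\<^sup>2 \<le> x \<bullet> (M *v x)" if "x \<bullet> u = 0" for x
  proof (cases "x = 0")
    case False
    then have "(1 / norm x) *\<^sub>R x \<in> S" using that by (simp add: S_def inner_commute)
    from vmin[OF this] have "m \<le> (1 / norm x)\<^sup>2 * (x \<bullet> (M *v x))"
      by (simp add: m_def matrix_vector_mult_scaleR power2_eq_square)
    then have "m * (norm x)\<^sup>2 \<le> ((1 / norm x)\<^sup>2 * (x \<bullet> (M *v x))) * (norm x)\<^sup>2"
      by (rule mult_right_mono) simp
    then show ?thesis using False by (simp add: power_divide)
  qed simp
  \<comment> \<open>The residual of the eigenvalue equation at the minimiser. It is orthogonal to
    \<open>u\<close> because \<open>M\<close> is symmetric and kills \<open>u\<close>, so
    \<open>v + t *\<^sub>R y\<close> remains admissible in \<open>bound\<close>.\<close>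
  define y where "y = M *v v - m *\<^sub>R v"
  have yu: "y \<bullet> u = 0" by (simp add: y_def inner_diff_left inner_M ker vu)
  define b where "b = y \<bullet> (M *v y) - m * (norm y)\<^sup>2"
  have b: "b \<ge> 0" using bound[OF yu] by (simp add: b_def)
  \<comment> \<open>The form of \<open>M\<close> minus \<open>m\<close> times the identity is
    nonnegative on the complement of \<open>u\<close> and vanishes at \<open>v\<close>. Along the
    line through \<open>v\<close> in direction \<open>y\<close> it therefore has no constant term,
    and its linear coefficient is twice the squared norm of \<open>y\<close>.\<close>
  have quad: "0 \<le> 2 * t * (norm y)\<^sup>2 + t\<^sup>2 * b" for t
  proof -
    have "(v + t *\<^sub>R y) \<bullet> u = 0" by (simp add: inner_add_left vu yu)
    from bound[OF this]
    have "0 \<le> (v + t *\<^sub>R y) \<bullet> (M *v (v + t *\<^sub>R y) - m *\<^sub>R (v + t *\<^sub>R y))"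
      by (simp add: inner_diff_right power2_norm_eq_inner)
    also have "M *v (v + t *\<^sub>R y) - m *\<^sub>R (v + t *\<^sub>R y) = y + t *\<^sub>R (M *v y - m *\<^sub>R y)"
      by (simp add: y_def matrix_vector_right_distrib matrix_vector_mult_scaleR algebra_simps)
    also have "(v + t *\<^sub>R y) \<bullet> \<dots> =
        v \<bullet> y + t * (v \<bullet> (M *v y) - m * (v \<bullet> y)) + t * (y \<bullet> y) + t\<^sup>2 * b"
      by (simp add: b_def inner_add inner_diff_right algebra_simps power2_eq_square
          power2_norm_eq_inner[unfolded power2_eq_square])
    also have "v \<bullet> (M *v y) - m * (v \<bullet> y) = y \<bullet> y"
      by (simp add: inner_M[symmetric]) (simp add: y_def inner_diff_left)
    also have "v \<bullet> y = 0"
      using nv by (simp add: y_def inner_diff_right m_def norm_eq_1)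
    finally show ?thesis by (simp add: power2_norm_eq_inner)
  qed
  have "y = 0"
  proof (rule ccontr)
    assume "y \<noteq> 0"
    define a where "a = (norm y)\<^sup>2"
    have a: "a > 0" using \<open>y \<noteq> 0\<close> by (simp add: a_def)
    \<comment> \<open>For \<open>b > 0\<close> the minimiser would be \<open>- a / b\<close>. The
      denominator \<open>b + 1\<close> also covers \<open>b = 0\<close> and still makes the
      quadratic negative.\<close>
    define t where "t = - a / (b + 1)"
    have "2 * t * a + t\<^sup>2 * b = - (a / (b + 1)) * a * (2 - b / (b + 1))"
      by (simp add: t_def power2_eq_square algebra_simps)
    moreover have "b / (b + 1) < 1" using b by simp
    then have "0 < 2 - b / (b + 1)" by linarith
    then have "a / (b + 1) * a * (2 - b / (b + 1)) > 0"
      using a b by (intro mult_pos_pos divide_pos_pos) auto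
    ultimately show False using quad[of t] by (simp add: a_def)
  qed
  then have "eigenvalue M m" unfolding eigenvalue_def y_def using v0 by auto
  \<comment> \<open>An eigenvector for a positive eigenvalue is orthogonal to the null vector
    \<open>u\<close>, so the Rayleigh bound applies to it.\<close>
  moreover have "m \<le> \<mu>" if \<mu>: "\<mu> > 0" and ev: "eigenvalue M \<mu>" for \<mu>
  proof -
    obtain w where w: "w \<noteq> 0" "M *v w = \<mu> *\<^sub>R w" using ev unfolding eigenvalue_def by blast
    have "\<mu> * (w \<bullet> u) = (M *v w) \<bullet> u" by (simp add: w)
    also have "\<dots> = 0" by (simp add: inner_M ker)
    finally have "w \<bullet> u = 0" using \<mu> by simp
    from bound[OF this] have "m * (norm w)\<^sup>2 \<le> \<mu> * (norm w)\<^sup>2"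
      by (simp add: w power2_norm_eq_inner)
    then show ?thesis using w by simp
  qed
  ultimately have "smallest_pos_eigenvalue M = m"
    unfolding smallest_pos_eigenvalue_def using m by (intro Least_equality) auto
  then show "0 < smallest_pos_eigenvalue M"
    and "x \<bullet> u = 0 \<Longrightarrow> smallest_pos_eigenvalue M * (norm x)\<^sup>2 \<le> x \<bullet> (M *v x)"
    using m bound by auto
qed

section \<open>Positivity of the left null vector of the Laplacian\<close>

text \<open>Zeros spread along edges: if \<open>p $ j = 0\<close>, the null equation at
  \<open>j\<close> is a vanishing sum of nonnegative terms, which forces \<open>p $ i = 0\<close> at
  every out-neighbour \<open>i\<close> of \<open>j\<close>. Strong connectivity carries this to all
  nodes.\<close>

lemma nonneg_left_null_vector_zero:
  assumes "strongly_connected_digraph A" "weighted_digraph A"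
    and null: "p v* laplacian A = 0" and nonneg: "\<And>i. 0 \<le> p $ i" and "p $ j = 0"
  shows "p = 0"
proof -
  have step: "p $ i = 0" if "p $ j = 0" "(j, i) \<in> edges A" for i j
  proof -
    have "(\<Sum>k\<in>UNIV. p $ k * A $ k $ j) = 0"
      using vec_mult_laplacian[of p A j] null that by simp
    then have "p $ i * A $ i $ j = 0"
      using nonneg assms(2) by (subst (asm) sum_nonneg_eq_0_iff) (auto simp: weighted_digraph_def)
    then show ?thesis using that by (auto simp: edges_def)
  qed
  have "p $ i = 0" for i
  proof -
    have "(j, i) \<in> (edges A)\<^sup>*" using assms(1) by (simp add: strongly_connected_digraph_def)
    then show ?thesis by induction (use \<open>p $ j = 0\<close> step in auto)
  qed
  then show ?thesis by (simp add: vec_eq_iff)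
qed

text \<open>The triangle inequality makes each defect \<open>g j\<close> nonnegative. The rows of a
  Laplacian sum to zero, so the defects also sum to zero, and hence each of them vanishes.\<close>

lemma abs_left_null_vector:
  fixes A :: "real ^ 'n ^ 'n"
  assumes "weighted_digraph A" and null: "p v* laplacian A = 0"
  shows "(\<chi> i. \<bar>p $ i\<bar>) v* laplacian A = 0"
proof -
  have eq: "p $ j * (\<Sum>k\<in>UNIV. A $ j $ k) = (\<Sum>i\<in>UNIV. p $ i * A $ i $ j)" for j
    using vec_mult_laplacian[of p A j] null by simp
  have A: "A $ i $ j \<ge> 0" for i j using assms by (simp add: weighted_digraph_def)
  define g where "g j = (\<Sum>i\<in>UNIV. \<bar>p $ i\<bar> * A $ i $ j) - \<bar>p $ j\<bar> * (\<Sum>k\<in>UNIV. A $ j $ k)" for j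
  have "0 \<le> g j" for j
  proof -
    have "\<bar>p $ j\<bar> * (\<Sum>k\<in>UNIV. A $ j $ k) = \<bar>\<Sum>i\<in>UNIV. p $ i * A $ i $ j\<bar>"
      by (simp add: eq[symmetric] abs_mult abs_of_nonneg sum_nonneg A)
    also have "\<dots> \<le> (\<Sum>i\<in>UNIV. \<bar>p $ i * A $ i $ j\<bar>)" by (rule sum_abs)
    finally show ?thesis by (simp add: g_def abs_mult abs_of_nonneg A)
  qed
  moreover have "(\<Sum>j\<in>UNIV. g j) = 0"
    unfolding g_def sum_subtractf sum_distrib_left by (subst sum.swap) simp
  ultimately have "g j = 0" for j
    by (subst (asm) sum_nonneg_eq_0_iff) auto
  then show ?thesis by (simp add: vec_eq_iff vec_mult_laplacian g_def)
qed

section \<open>The Dirichlet form of the balanced Laplacian and its spectral gap\<close>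

locale strongly_connected_left_eigenvector =
  fixes A :: "real ^ 'n ^ 'n" and \<xi> :: "real ^ 'n"
  assumes digraph: "weighted_digraph A"
    and connected: "strongly_connected_digraph A"
    and left_null: "\<xi> v* laplacian A = 0"
    and sum_xi: "(\<Sum>i\<in>UNIV. \<xi> $ i) = 1"
    and card: "CARD('n) \<ge> 2"
begin

text \<open>Zero propagation is used twice. Twice the negative part of \<open>\<xi>\<close> is a
  nonnegative null vector that vanishes where \<open>\<xi>\<close> is positive, which happens
  somewhere because the entries sum to 1; so \<open>\<xi>\<close> is nonnegative. A zero entry would
  then make \<open>\<xi>\<close> itself vanish.\<close>

lemma xi_pos: "0 < \<xi> $ i"
proof -
  define n where "n = (\<chi> i. \<bar>\<xi> $ i\<bar>) - \<xi>"
  have "n v* laplacian A = 0"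
    using abs_left_null_vector[OF digraph left_null] left_null
    by (simp add: n_def vec_eq_iff vector_matrix_mult_def left_diff_distrib right_diff_distrib sum_subtractf)
  moreover have "0 \<le> n $ i" for i by (simp add: n_def)
  moreover have "\<exists>j. 0 < \<xi> $ j"
    using sum_xi sum_nonpos[of UNIV "\<lambda>i. \<xi> $ i"] by (force simp: not_less[symmetric])
  then obtain j where "0 < \<xi> $ j" by blast
  then have "n $ j = 0" by (simp add: n_def)
  ultimately have "n = 0"
    using nonneg_left_null_vector_zero[OF connected digraph] by blast
  then have nonneg: "0 \<le> \<xi> $ k" for k
    by (simp add: n_def vec_eq_iff abs_eq_iff')
  show ?thesis
  proof (rule ccontr)
    assume "\<not> 0 < \<xi> $ i"
    then have "\<xi> $ i = 0" using nonneg[of i] by simp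
    then have "\<xi> = 0"
      using nonneg_left_null_vector_zero[OF connected digraph left_null nonneg] by blast
    then show False using sum_xi by simp
  qed
qed

lemma inner_xi_laplacian: "\<xi> \<bullet> (laplacian A *v x) = 0"
  by (metis dot_lmul_matrix inner_zero_left left_null)

text \<open>The digraph with weights \<open>\<xi> $ i * A $ i $ j\<close> is
  weight-balanced.\<close>

lemma balance: "\<xi> $ j * (\<Sum>k\<in>UNIV. A $ j $ k) = (\<Sum>i\<in>UNIV. \<xi> $ i * A $ i $ j)"
  using vec_mult_laplacian[of \<xi> A j] left_null by simp

text \<open>By \<open>balance\<close> the weighted sums of the squares of \<open>x $ i\<close> and
  of \<open>x $ j\<close> coincide, so adding their difference to twice
  \<open>x $ i * (x $ i - x $ j)\<close> costs nothing and completes the square.\<close>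

lemma dirichlet_form:
  "x \<bullet> ((diag \<xi> ** laplacian A) *v x) =
     (\<Sum>i\<in>UNIV. \<Sum>j\<in>UNIV. \<xi> $ i * A $ i $ j * (x $ i - x $ j)\<^sup>2) / 2"
proof -
  have "(\<Sum>i\<in>UNIV. \<Sum>j\<in>UNIV. \<xi> $ i * A $ i $ j * (x $ j)\<^sup>2)
      = (\<Sum>j\<in>UNIV. (\<Sum>i\<in>UNIV. \<xi> $ i * A $ i $ j) * (x $ j)\<^sup>2)"
    by (subst sum.swap) (simp add: sum_distrib_right)
  also have "\<dots> = (\<Sum>i\<in>UNIV. \<Sum>j\<in>UNIV. \<xi> $ i * A $ i $ j * (x $ i)\<^sup>2)"
    by (simp add: balance[symmetric] sum_distrib_left sum_distrib_right)
  finally have *: "(\<Sum>i\<in>UNIV. \<Sum>j\<in>UNIV. \<xi> $ i * A $ i $ j * (x $ j)\<^sup>2)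
      = (\<Sum>i\<in>UNIV. \<Sum>j\<in>UNIV. \<xi> $ i * A $ i $ j * (x $ i)\<^sup>2)" .
  have "(\<Sum>i\<in>UNIV. \<Sum>j\<in>UNIV. \<xi> $ i * A $ i $ j * (x $ i - x $ j)\<^sup>2)
     = (\<Sum>i\<in>UNIV. \<Sum>j\<in>UNIV. 2 * (\<xi> $ i * A $ i $ j * (x $ i * (x $ i - x $ j)))
         + (\<xi> $ i * A $ i $ j * (x $ j)\<^sup>2 - \<xi> $ i * A $ i $ j * (x $ i)\<^sup>2))"
    by (intro sum.cong refl) (simp add: power2_eq_square algebra_simps)
  also have "\<dots> = 2 * (\<Sum>i\<in>UNIV. \<Sum>j\<in>UNIV. \<xi> $ i * A $ i $ j * (x $ i * (x $ i - x $ j)))"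
    by (simp add: sum.distrib sum_subtractf * sum_distrib_left)
  also have "(\<Sum>i\<in>UNIV. \<Sum>j\<in>UNIV. \<xi> $ i * A $ i $ j * (x $ i * (x $ i - x $ j)))
      = x \<bullet> ((diag \<xi> ** laplacian A) *v x)"
    by (simp add: inner_vec_def diag_matrix_mult_vec laplacian_mult_vec sum_distrib_left mult_ac)
  finally show ?thesis by simp
qed

abbreviation lambda2 :: real where
  "lambda2 \<equiv> smallest_pos_eigenvalue (Sym (diag \<xi> ** laplacian A))"

text \<open>The Laplacian kills constants, and its transpose kills \<open>\<xi>\<close>, which is
  the image of \<open>1\<close> under \<open>diag \<xi>\<close>.\<close>

lemma Sym_laplacian_one: "Sym (diag \<xi> ** laplacian A) *v 1 = 0"
proof -
  have L1: "laplacian A *v 1 = 0" by (simp add: vec_eq_iff laplacian_mult_vec)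
  have "transpose (diag \<xi>) *v (1 :: real ^ 'n) = \<xi>"
    by (simp add: vec_eq_iff transpose_def diag_def matrix_vector_mult_def)
  then have "transpose (diag \<xi> ** laplacian A) *v 1 = 0"
    by (simp add: matrix_transpose_mul matrix_vector_mul_assoc[symmetric] transpose_matrix_vector
        left_null)
  then show ?thesis
    by (simp add: Sym_def scaleR_matrix_vector_assoc[symmetric] matrix_vector_mult_add_rdistrib
        matrix_vector_mul_assoc[symmetric] L1)
qed

text \<open>Otherwise every term of the Dirichlet form vanishes, so \<open>x\<close> is constant
  along edges, hence constant, and orthogonality to \<open>1\<close> makes it zero.\<close>

lemma dirichlet_form_pos:
  assumes "x \<bullet> 1 = 0" "x \<noteq> 0"
  shows "0 < x \<bullet> (Sym (diag \<xi> ** laplacian A) *v x)"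
proof (rule ccontr)
  let ?f = "\<lambda>i j. \<xi> $ i * A $ i $ j * (x $ i - x $ j)\<^sup>2"
  assume "\<not> ?thesis"
  moreover have nonneg: "0 \<le> ?f i j" for i j
    using xi_pos[of i] digraph by (simp add: weighted_digraph_def less_imp_le)
  ultimately have "(\<Sum>i\<in>UNIV. \<Sum>j\<in>UNIV. ?f i j) = 0"
    unfolding inner_Sym dirichlet_form by (intro antisym sum_nonneg) auto
  then have zero: "?f i j = 0" for i j
    using nonneg by (simp add: sum_nonneg_eq_0_iff sum_nonneg) blast
  then have step: "x $ i = x $ j" if "(j, i) \<in> edges A" for i j
    using that xi_pos[of i] zero[of i j] by (auto simp: edges_def)
  have const: "x $ i = x $ j" for i j
  proof -
    have "(j, i) \<in> (edges A)\<^sup>*" using connected by (simp add: strongly_connected_digraph_def)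
    then show ?thesis by induction (use step in auto)
  qed
  fix k
  have "x \<bullet> 1 = (\<Sum>i\<in>(UNIV :: 'n set). x $ k)"
    unfolding inner_vec_def by (intro sum.cong refl) (simp, rule const)
  then have "x \<bullet> 1 = CARD('n) * x $ k" by simp
  then have "x $ k = 0" using assms by simp
  then have "x = 0" by (metis const vec_eq_iff zero_index)
  then show False using assms by simp
qed

lemma lambda2_pos: "0 < lambda2"
  and lambda2_le: "x \<bullet> 1 = 0 \<Longrightarrow> lambda2 * (norm x)\<^sup>2 \<le> x \<bullet> ((diag \<xi> ** laplacian A) *v x)"
proof -
  \<comment> \<open>Two distinct players supply a nonzero vector orthogonal to \<open>1\<close>, on
    which the minimisation of the Rayleigh quotient rests.\<close>
  obtain i j :: 'n where "i \<noteq> j"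
    using card card_le_Suc0_iff_eq[of "UNIV :: 'n set"] by auto
  then have "axis i 1 - axis j 1 \<noteq> (0 :: real ^ 'n)"
    by (auto simp: axis_eq_axis)
  moreover have "(axis i 1 - axis j 1) \<bullet> (1 :: real ^ 'n) = 0"
    by (simp add: inner_diff_left inner_axis')
  ultimately have ne: "\<exists>x. x \<noteq> 0 \<and> x \<bullet> (1 :: real ^ 'n) = 0" by blast
  note * = smallest_pos_eigenvalue_rayleigh[OF transpose_Sym Sym_laplacian_one dirichlet_form_pos ne]
  show "0 < lambda2" using *(1) by blast
  show "x \<bullet> 1 = 0 \<Longrightarrow> lambda2 * (norm x)\<^sup>2 \<le> x \<bullet> ((diag \<xi> ** laplacian A) *v x)"
    using *(2)[of x] by (simp add: inner_Sym)
qed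

text \<open>The Dirichlet form depends on differences only, so removing the mean does not change
  it.\<close>

lemma lambda2_le_centered:
  "lambda2 * (norm (x - vec ((\<Sum>i\<in>UNIV. x $ i) / CARD('n))))\<^sup>2 \<le> x \<bullet> ((diag \<xi> ** laplacian A) *v x)"
proof -
  define w where "w = x - vec ((\<Sum>i\<in>UNIV. x $ i) / CARD('n))"
  have "w \<bullet> 1 = 0" by (simp add: w_def inner_vec_def sum_subtractf)
  from lambda2_le[OF this] have "lambda2 * (norm w)\<^sup>2 \<le> w \<bullet> ((diag \<xi> ** laplacian A) *v w)" .
  also have "\<dots> = x \<bullet> ((diag \<xi> ** laplacian A) *v x)"
    unfolding dirichlet_form by (simp add: w_def)
  finally show ?thesis by (simp add: w_def)
qed

section \<open>Exponential convergence of the eigenvector estimates\<close>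

lemma consensus_decay:
  assumes deriv: "\<And>t. 0 \<le> t \<Longrightarrow>
      (w has_vector_derivative - (laplacian A *v w t)) (at t within {0..})"
    and start: "\<xi> \<bullet> w 0 = 0" and t: "0 \<le> t"
  shows "\<xi> $ k * (w t $ k)\<^sup>2 \<le> (\<Sum>i\<in>UNIV. \<xi> $ i * (w 0 $ i)\<^sup>2) * exp (- (2 * lambda2) * t)"
proof -
  define W where "W s = (\<Sum>i\<in>UNIV. \<xi> $ i * (w s $ i)\<^sup>2)" for s
  have w': "((\<lambda>s. w s $ i) has_real_derivative - (laplacian A *v w s) $ i) (at s within {0..})"
    if "0 \<le> s" for s i
    using bounded_linear.has_vector_derivative[OF bounded_linear_vec_nth deriv[OF that], of i]
    by (simp add: has_real_derivative_iff_has_vector_derivative)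
  have inner': "((\<lambda>s. \<xi> \<bullet> w s) has_real_derivative 0) (at s within {0..})" if "0 \<le> s" for s
    using bounded_linear.has_vector_derivative[OF bounded_linear_inner_right deriv[OF that], of \<xi>]
    by (simp add: has_real_derivative_iff_has_vector_derivative inner_xi_laplacian)
  have "\<exists>c. \<forall>s\<in>{0..}. \<xi> \<bullet> w s = c"
    by (rule has_field_derivative_zero_constant) (auto intro: inner')
  then have conserved: "\<xi> \<bullet> w s = 0" if "0 \<le> s" for s
    using start that by (metis atLeast_iff order_refl)
  have W': "(W has_real_derivative - 2 * (w s \<bullet> ((diag \<xi> ** laplacian A) *v w s)))
      (at s within {0..})" if "0 \<le> s" for s
    unfolding W_def
    by (rule derivative_eq_intros w'[OF that] refl)+
      (simp add: inner_vec_def diag_matrix_mult_vec sum_distrib_left mult_ac sum_negf)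
  \<comment> \<open>Written as the instance \<open>K = 0\<close>, \<open>\<beta> = 1\<close> of the
    perturbed decay estimate.\<close>
  have W_le: "- 2 * (w s \<bullet> ((diag \<xi> ** laplacian A) *v w s)) \<le> - (2 * lambda2 - 0 * exp (- 1 * s)) * W s"
    if "0 \<le> s" for s
  proof -
    \<comment> \<open>The spectral gap concerns centring at the arithmetic mean \<open>m\<close>,
      whereas \<open>W\<close> is weighted by \<open>\<xi>\<close>. On the hyperplane where
      \<open>\<xi> \<bullet> w s = 0\<close>, subtracting any constant \<open>m\<close> raises the
      weighted sum by \<open>m\<^sup>2\<close>, so centring loses nothing; then
      \<open>xi_le_1\<close> removes the weights.\<close>
    define m where "m = (\<Sum>i\<in>UNIV. w s $ i) / CARD('n)"
    have xi_le_1: "\<xi> $ i \<le> 1" for i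
      using sum_xi member_le_sum[of i UNIV "\<lambda>i. \<xi> $ i"] xi_pos by (simp add: less_imp_le)
    have "(\<Sum>i\<in>UNIV. \<xi> $ i * (w s $ i - m)\<^sup>2)
        = (\<Sum>i\<in>UNIV. \<xi> $ i * (w s $ i)\<^sup>2 - (2 * m) * (\<xi> $ i * w s $ i) + m\<^sup>2 * \<xi> $ i)"
      by (intro sum.cong refl) (simp add: power2_eq_square algebra_simps)
    also have "\<dots> = W s - 2 * m * (\<xi> \<bullet> w s) + m\<^sup>2 * (\<Sum>i\<in>UNIV. \<xi> $ i)"
      by (simp add: W_def sum.distrib sum_subtractf sum_distrib_left inner_vec_def)
    also have "\<dots> = W s + m\<^sup>2" by (simp add: conserved[OF that] sum_xi)
    finally have "W s \<le> (\<Sum>i\<in>UNIV. \<xi> $ i * (w s $ i - m)\<^sup>2)" by simp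
    also have "\<dots> \<le> (\<Sum>i\<in>UNIV. (w s $ i - m)\<^sup>2)"
      using xi_le_1 by (intro sum_mono mult_left_le_one_le) (simp_all add: less_imp_le[OF xi_pos])
    also have "\<dots> = (norm (w s - vec m))\<^sup>2"
      unfolding power2_norm_eq_inner by (simp add: inner_vec_def power2_eq_square)
    finally have "lambda2 * W s \<le> lambda2 * (norm (w s - vec m))\<^sup>2"
      using lambda2_pos by simp
    also have "\<dots> \<le> w s \<bullet> ((diag \<xi> ** laplacian A) *v w s)"
      unfolding m_def by (rule lambda2_le_centered)
    finally show ?thesis by simp
  qed
  have nonneg: "0 \<le> \<xi> $ i * (w s $ i)\<^sup>2" for s i by (simp add: less_imp_le[OF xi_pos])
  have "\<xi> $ k * (w t $ k)\<^sup>2 \<le> W t"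
    unfolding W_def by (rule member_le_sum) (auto simp: nonneg)
  also have "W t \<le> W 0 * exp (0 / 1) * exp (- (2 * lambda2) * t)"
    by (rule exp_decay_of_differential_inequality[OF W' W_le]) (auto simp: W_def sum_nonneg nonneg t)
  finally show ?thesis by (simp add: W_def)
qed

text \<open>The estimates decouple by component: for fixed \<open>k\<close>, the errors of all
  players in component \<open>k\<close> follow the linear consensus flow. They start at
  \<open>axis k 1\<close> minus the constant \<open>\<xi> $ k\<close>, which is orthogonal to
  \<open>\<xi>\<close> since the entries of \<open>\<xi>\<close> sum to 1.\<close>

lemma left_eigenvector_estimate_converges:
  assumes deriv: "\<And>i t. 0 \<le> t \<Longrightarrow>
      ((\<lambda>t. \<Xi> t $ i) has_vector_derivative
         - (\<Sum>j\<in>UNIV. A $ i $ j *\<^sub>R (\<Xi> t $ i - \<Xi> t $ j))) (at t within {0..})"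
    and start: "\<And>i j. \<Xi> 0 $ i $ j = (if j = i then 1 else 0)"
  shows "\<exists>C\<ge>0. \<forall>t\<ge>0. \<forall>i. \<bar>\<Xi> t $ i $ i - \<xi> $ i\<bar> \<le> C * exp (- lambda2 * t)"
proof -
  define w where "w k t = (\<chi> i. \<Xi> t $ i $ k - \<xi> $ k)" for k t
  have w': "(w k has_vector_derivative - (laplacian A *v w k t)) (at t within {0..})"
    if "0 \<le> t" for k t
  proof -
    have "((\<lambda>t. w k t $ i) has_vector_derivative (- (laplacian A *v w k t)) $ i) (at t within {0..})" for i
    proof -
      have "((\<lambda>t. \<Xi> t $ i $ k - \<xi> $ k) has_vector_derivative
          (- (\<Sum>j\<in>UNIV. A $ i $ j *\<^sub>R (\<Xi> t $ i - \<Xi> t $ j))) $ k - 0) (at t within {0..})"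
        by (intro has_vector_derivative_diff has_vector_derivative_const
            bounded_linear.has_vector_derivative[OF bounded_linear_vec_nth] deriv that)
      then show ?thesis by (simp add: w_def laplacian_mult_vec)
    qed
    then show ?thesis
      unfolding has_vector_derivative_def
      by (subst has_derivative_componentwise_within) (auto simp: Basis_vec_def inner_axis)
  qed
  have w0: "\<xi> \<bullet> w k 0 = 0" for k
  proof -
    have "\<xi> \<bullet> w k 0 = (\<Sum>i\<in>UNIV. (if i = k then \<xi> $ i else 0) - \<xi> $ i * \<xi> $ k)"
      unfolding inner_vec_def w_def by (intro sum.cong refl) (simp add: start algebra_simps)
    also have "\<dots> = \<xi> $ k - (\<Sum>i\<in>UNIV. \<xi> $ i) * \<xi> $ k"
      by (simp add: sum_subtractf sum_distrib_right)
    finally show ?thesis by (simp add: sum_xi)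
  qed
  \<comment> \<open>The initial Lyapunov value divided by the weight of the \<open>k\<close>-th
    entry. Taking square roots halves the rate to \<open>lambda2\<close>.\<close>
  define D where "D k = (\<Sum>i\<in>UNIV. \<xi> $ i * (w k 0 $ i)\<^sup>2) / \<xi> $ k" for k
  have D: "0 \<le> D k" for k
    unfolding D_def by (intro divide_nonneg_nonneg sum_nonneg) (simp_all add: less_imp_le[OF xi_pos])
  have bound: "\<bar>\<Xi> t $ k $ k - \<xi> $ k\<bar> \<le> sqrt (D k) * exp (- lambda2 * t)" if "0 \<le> t" for t k
  proof -
    have "\<xi> $ k * (w k t $ k)\<^sup>2 \<le> \<xi> $ k * (D k * exp (- (2 * lambda2) * t))"
      using consensus_decay[OF w' w0 that, of k k] xi_pos[of k] by (simp add: D_def)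
    then have "(w k t $ k)\<^sup>2 \<le> D k * exp (- (2 * lambda2) * t)"
      using xi_pos[of k] by simp
    also have "\<dots> = (sqrt (D k) * exp (- lambda2 * t))\<^sup>2"
      using D[of k] by (simp add: power_mult_distrib exp_double[symmetric])
    finally have "\<bar>w k t $ k\<bar> \<le> sqrt (D k) * exp (- lambda2 * t)"
      using D[of k] by (simp add: abs_le_square_iff[symmetric])
    then show ?thesis by (simp add: w_def)
  qed
  show ?thesis
  proof (intro exI conjI allI impI)
    show "0 \<le> (\<Sum>k\<in>UNIV. sqrt (D k))" by (intro sum_nonneg) (simp add: D)
    fix t :: real and k assume "0 \<le> t"
    have "sqrt (D k) \<le> (\<Sum>k\<in>UNIV. sqrt (D k))"
      by (rule member_le_sum) (auto simp: D)
    then have "sqrt (D k) * exp (- lambda2 * t) \<le> (\<Sum>k\<in>UNIV. sqrt (D k)) * exp (- lambda2 * t)"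
      by (rule mult_right_mono) simp
    then show "\<bar>\<Xi> t $ k $ k - \<xi> $ k\<bar> \<le> (\<Sum>k\<in>UNIV. sqrt (D k)) * exp (- lambda2 * t)"
      using bound[OF \<open>0 \<le> t\<close>, of k] by linarith
  qed
qed

end

section \<open>Zeros of strongly monotone maps and Nash equilibria\<close>

lemma strongly_monotone_lipschitz_zero:
  fixes F :: "'a :: {real_inner, complete_space} \<Rightarrow> 'a"
  assumes mono: "strongly_monotone m F" and lip: "L-lipschitz_on UNIV F" and "0 < m"
  shows "\<exists>!x. F x = 0"
proof -
  \<comment> \<open>\<open>M\<close> is again a Lipschitz constant, and \<open>m \<le> M\<close>
    holds by construction, so the contraction factor \<open>c\<close> is well defined and below
    1.\<close>
  define M where "M = L + m"
  define c where "c = sqrt (1 - (m / M)\<^sup>2)"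
  \<comment> \<open>This step size minimises
    \<open>1 - 2 * (\<gamma> * m) + (\<gamma> * M)\<^sup>2\<close>, the bound for the squared
    contraction factor.\<close>
  define \<gamma> where "\<gamma> = m / M\<^sup>2"
  have L: "0 \<le> L" using lip by (rule lipschitz_on_nonneg)
  have M: "0 < M" "m \<le> M" "L \<le> M" using L \<open>0 < m\<close> by (auto simp: M_def)
  have \<gamma>: "0 < \<gamma>" using M \<open>0 < m\<close> by (simp add: \<gamma>_def)
  have r: "0 < (m / M)\<^sup>2" "(m / M)\<^sup>2 \<le> 1"
    using M \<open>0 < m\<close> by (auto simp: power_le_one)
  have contr: "dist (x - \<gamma> *\<^sub>R F x) (y - \<gamma> *\<^sub>R F y) \<le> c * dist x y" for x y
  proof (rule power2_le_imp_le)
    have lipM: "norm (F x - F y) \<le> M * norm (x - y)"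
      using lipschitz_onD[OF lip UNIV_I UNIV_I, of x y] mult_right_mono[OF M(3) norm_ge_zero[of "x - y"]]
      by (simp add: dist_norm)
    have "(dist (x - \<gamma> *\<^sub>R F x) (y - \<gamma> *\<^sub>R F y))\<^sup>2 = (norm ((x - y) - \<gamma> *\<^sub>R (F x - F y)))\<^sup>2"
      by (simp add: dist_norm algebra_simps)
    also have "\<dots> = (norm (x - y))\<^sup>2 - 2 * \<gamma> * ((x - y) \<bullet> (F x - F y)) + \<gamma>\<^sup>2 * (norm (F x - F y))\<^sup>2"
      unfolding power2_norm_eq_inner
      by (simp only: inner_diff_left inner_diff_right inner_scaleR_left inner_scaleR_right)
        (simp add: inner_commute power2_eq_square algebra_simps)
    also have "\<dots> \<le> (norm (x - y))\<^sup>2 - 2 * \<gamma> * (m * (norm (x - y))\<^sup>2) + \<gamma>\<^sup>2 * (M * norm (x - y))\<^sup>2"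
      using mono \<gamma> lipM unfolding strongly_monotone_def
      by (intro add_mono diff_mono mult_left_mono power_mono order_refl) auto
    also have "\<dots> = (1 - 2 * (\<gamma> * m) + (\<gamma> * M)\<^sup>2) * (norm (x - y))\<^sup>2"
      by (simp add: power_mult_distrib algebra_simps)
    also have "1 - 2 * (\<gamma> * m) + (\<gamma> * M)\<^sup>2 = 1 - (m / M)\<^sup>2"
      using M by (simp add: \<gamma>_def power2_eq_square field_simps)
    also have "\<dots> * (norm (x - y))\<^sup>2 = (c * dist x y)\<^sup>2"
      using r by (simp add: c_def power_mult_distrib dist_norm)
    finally show "(dist (x - \<gamma> *\<^sub>R F x) (y - \<gamma> *\<^sub>R F y))\<^sup>2 \<le> (c * dist x y)\<^sup>2" .
    show "0 \<le> c * dist x y" using r by (simp add: c_def)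
  qed
  have "\<exists>!x. x - \<gamma> *\<^sub>R F x = x"
    by (rule banach_fix_type[where c = c]) (use r contr in \<open>auto simp: c_def real_sqrt_lt_1_iff\<close>)
  then show ?thesis using \<gamma> by simp
qed

text \<open>Each player's cost is convex in the player's own decision, so a critical point of that
  slice is a global minimum; the converse is Fermat's criterion.\<close>

lemma nash_equilibrium_iff_pseudogradient_zero:
  assumes diff: "\<And>i. twice_continuously_differentiable (J i)"
    and conv: "\<And>i z. strictly_convex (\<lambda>s. J i (replace z i s))"
  shows "nash_equilibrium J z \<longleftrightarrow> pseudogradient J z = 0"
proof -
  have "(\<forall>s. J i z \<le> J i (replace z i s)) \<longleftrightarrow> partial_grad J i z = 0" for i
  proof -
    define f where "f s = J i (replace z i s)" for s
    \<comment> \<open>As an affine line, the slice inherits differentiability from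
      \<open>J i\<close> by the chain rule, so \<open>deriv\<close> in \<open>partial_grad\<close>
      is a true derivative.\<close>
    have lin: "replace z i s = z + (s - z $ i) *\<^sub>R axis i 1" for s
      by (simp add: replace_def vec_eq_iff axis_def)
    have fz: "f (z $ i) = J i z" by (simp add: f_def lin)
    obtain f' where f': "\<And>x. (J i has_derivative blinfun_apply (f' x)) (at x)"
      using diff[of i] unfolding twice_continuously_differentiable_def by blast
    have "((\<lambda>s. J i (z + (s - z $ i) *\<^sub>R axis i 1)) has_derivative
        (\<lambda>h. f' (z + (z $ i - z $ i) *\<^sub>R axis i 1) (h *\<^sub>R axis i 1))) (at (z $ i))"
      by (rule has_derivative_compose[OF _ f']) (auto intro!: derivative_eq_intros)
    then have "f differentiable at (z $ i)"
      unfolding f_def lin differentiable_def by blast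
    then obtain d where "(f has_real_derivative d) (at (z $ i))"
      using real_differentiableE by blast
    moreover have "partial_grad J i z = d"
      unfolding partial_grad_def by (rule DERIV_imp_deriv) (use calculation in \<open>simp add: f_def[abs_def]\<close>)
    ultimately have d: "(f has_real_derivative partial_grad J i z) (at (z $ i))" by simp
    have convex: "convex_on UNIV f"
    proof (rule convex_onI)
      fix t x y :: real assume "0 < t" "t < 1"
      then show "f ((1 - t) *\<^sub>R x + t *\<^sub>R y) \<le> (1 - t) * f x + t * f y"
        using conv[of i z, unfolded strictly_convex_def f_def[symmetric], rule_format, of x y t]
        by (cases "x = y") (auto simp: algebra_simps)
    qed simp
    show ?thesis
    proof
      assume "\<forall>s. J i z \<le> J i (replace z i s)"
      then show "partial_grad J i z = 0"
        by (intro DERIV_local_min[OF d, of 1]) (auto simp: fz, simp add: f_def)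
    next
      assume "partial_grad J i z = 0"
      then show "\<forall>s. J i z \<le> J i (replace z i s)"
        using convex_on_imp_above_tangent[OF convex _ _ _ d] fz by (simp add: f_def)
    qed
  qed
  then show ?thesis
    by (simp add: nash_equilibrium_def pseudogradient_def vec_eq_iff)
qed

section \<open>Mean and deviation of the stacked error\<close>

definition mean :: "'a::real_vector ^ 'n \<Rightarrow> 'a" where
  "mean x = (\<Sum>i\<in>UNIV. x $ i) /\<^sub>R CARD('n)"

text \<open>Pythagoras: the consensus part is orthogonal to the deviation, and it repeats the mean
  once per player.\<close>

lemma norm_mean_decomposition:
  fixes x :: "'a::real_inner ^ 'n"
  shows "(norm x)\<^sup>2 = CARD('n) * (norm (mean x))\<^sup>2 + (norm (x - vec (mean x)))\<^sup>2"
proof -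
  define m where "m = mean x"
  have sum_x: "(\<Sum>i\<in>UNIV. x $ i) = CARD('n) *\<^sub>R m"
    by (simp add: m_def mean_def)
  have "vec m \<bullet> x = m \<bullet> (\<Sum>i\<in>UNIV. x $ i)" by (simp add: inner_vec_def inner_sum_right)
  then have 1: "vec m \<bullet> x = CARD('n) * (m \<bullet> m)" by (simp add: sum_x)
  have 2: "vec m \<bullet> (vec m :: 'a ^ 'n) = CARD('n) * (m \<bullet> m)" by (simp add: inner_vec_def)
  show ?thesis
    unfolding m_def[symmetric] power2_norm_eq_inner
    by (simp add: inner_diff inner_commute[of x "vec m"] 1 2)
qed

context strongly_connected_left_eigenvector
begin

text \<open>The coupling acts on each coordinate \<open>k\<close> separately, so the scalar spectral
  bound is applied to each slice \<open>x k\<close> and summed.\<close>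

lemma lambda2_le_stacked:
  fixes e :: "(real ^ 'm) ^ 'n"
  shows "lambda2 * (norm (e - vec (mean e)))\<^sup>2
    \<le> (\<Sum>i\<in>UNIV. \<xi> $ i * (e $ i \<bullet> (\<Sum>j\<in>UNIV. A $ i $ j *\<^sub>R (e $ i - e $ j))))"
proof -
  define x where "x k = (\<chi> i. e $ i $ k)" for k
  have "(norm (e - vec (mean e)))\<^sup>2
      = (\<Sum>i\<in>UNIV. \<Sum>k\<in>UNIV. (e $ i $ k - mean e $ k)\<^sup>2)"
    unfolding power2_norm_eq_inner by (simp add: inner_vec_def power2_eq_square)
  also have "\<dots> = (\<Sum>k\<in>UNIV. \<Sum>i\<in>UNIV. (e $ i $ k - mean e $ k)\<^sup>2)"
    by (rule sum.swap)
  also have "\<dots> = (\<Sum>k\<in>UNIV. (norm (x k - vec ((\<Sum>i\<in>UNIV. x k $ i) / CARD('n))))\<^sup>2)"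
    unfolding power2_norm_eq_inner
    by (simp add: inner_vec_def power2_eq_square x_def mean_def divide_inverse mult.commute)
  finally have "lambda2 * (norm (e - vec (mean e)))\<^sup>2
      = (\<Sum>k\<in>UNIV. lambda2 * (norm (x k - vec ((\<Sum>i\<in>UNIV. x k $ i) / CARD('n))))\<^sup>2)"
    by (simp add: sum_distrib_left)
  also have "\<dots> \<le> (\<Sum>k\<in>UNIV. x k \<bullet> ((diag \<xi> ** laplacian A) *v x k))"
    by (intro sum_mono lambda2_le_centered)
  also have "\<dots> = (\<Sum>k\<in>UNIV. \<Sum>i\<in>UNIV.
      \<xi> $ i * (e $ i $ k * (\<Sum>j\<in>UNIV. A $ i $ j * (e $ i $ k - e $ j $ k))))"
    by (simp add: inner_vec_def diag_matrix_mult_vec laplacian_mult_vec x_def mult_ac)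
  also have "\<dots> = (\<Sum>i\<in>UNIV. \<Sum>k\<in>UNIV.
      \<xi> $ i * (e $ i $ k * (\<Sum>j\<in>UNIV. A $ i $ j * (e $ i $ k - e $ j $ k))))"
    by (rule sum.swap)
  also have "\<dots> = (\<Sum>i\<in>UNIV. \<xi> $ i * (e $ i \<bullet> (\<Sum>j\<in>UNIV. A $ i $ j *\<^sub>R (e $ i - e $ j))))"
    by (simp add: inner_vec_def sum_distrib_left)
  finally show ?thesis .
qed

end

text \<open>Controls the error from using the estimates in place of \<open>\<xi>\<close>:
  \<open>c i\<close> will be the discrepancy at player \<open>i\<close>. Cauchy-Schwarz with the
  crude bounds \<open>norm e\<close> for a block and \<open>2 * norm e\<close> for a difference
  suffices, since the discrepancies decay.\<close>

lemma weighted_coupling_bound: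
  fixes A :: "real ^ 'n ^ 'n" and e :: "'a::real_inner ^ 'n"
  assumes "weighted_digraph A" and c: "\<And>i. \<bar>c i\<bar> \<le> \<delta>"
  shows "\<bar>\<Sum>i\<in>UNIV. c i * (e $ i \<bullet> (\<Sum>j\<in>UNIV. A $ i $ j *\<^sub>R (e $ i - e $ j)))\<bar>
    \<le> \<delta> * (2 * (\<Sum>i\<in>UNIV. \<Sum>j\<in>UNIV. A $ i $ j)) * (norm e)\<^sup>2"
proof -
  have A: "0 \<le> A $ i $ j" for i j using assms(1) by (simp add: weighted_digraph_def)
  have \<delta>: "0 \<le> \<delta>" using c[of undefined] by linarith
  have "\<bar>c i * (e $ i \<bullet> (\<Sum>j\<in>UNIV. A $ i $ j *\<^sub>R (e $ i - e $ j)))\<bar>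
      \<le> \<delta> * (\<Sum>j\<in>UNIV. A $ i $ j * (2 * (norm e)\<^sup>2))" for i
  proof -
    have "\<bar>e $ i \<bullet> (\<Sum>j\<in>UNIV. A $ i $ j *\<^sub>R (e $ i - e $ j))\<bar>
        \<le> (\<Sum>j\<in>UNIV. \<bar>e $ i \<bullet> (A $ i $ j *\<^sub>R (e $ i - e $ j))\<bar>)"
      unfolding inner_sum_right by (rule sum_abs)
    also have "\<dots> \<le> (\<Sum>j\<in>UNIV. A $ i $ j * (2 * (norm e)\<^sup>2))"
    proof (rule sum_mono)
      fix j
      have "norm (e $ i - e $ j) \<le> norm e + norm e"
        using norm_triangle_ineq4[of "e $ i" "e $ j"]
          Finite_Cartesian_Product.norm_nth_le[of e i] Finite_Cartesian_Product.norm_nth_le[of e j]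
        by linarith
      then have "norm (e $ i) * norm (e $ i - e $ j) \<le> norm e * (norm e + norm e)"
        by (intro mult_mono Finite_Cartesian_Product.norm_nth_le) auto
      then have "\<bar>e $ i \<bullet> (e $ i - e $ j)\<bar> \<le> 2 * (norm e)\<^sup>2"
        using Cauchy_Schwarz_ineq2[of "e $ i" "e $ i - e $ j"] by (simp add: power2_eq_square)
      then show "\<bar>e $ i \<bullet> (A $ i $ j *\<^sub>R (e $ i - e $ j))\<bar> \<le> A $ i $ j * (2 * (norm e)\<^sup>2)"
        unfolding inner_scaleR_right abs_mult abs_of_nonneg[OF A] by (rule mult_left_mono) (rule A)
    qed
    finally show ?thesis unfolding abs_mult by (intro mult_mono c \<delta>) auto
  qed
  then have "\<bar>\<Sum>i\<in>UNIV. c i * (e $ i \<bullet> (\<Sum>j\<in>UNIV. A $ i $ j *\<^sub>R (e $ i - e $ j)))\<bar>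
      \<le> (\<Sum>i\<in>UNIV. \<delta> * (\<Sum>j\<in>UNIV. A $ i $ j * (2 * (norm e)\<^sup>2)))"
    by (intro order_trans[OF sum_abs] sum_mono)
  also have "\<dots> = \<delta> * (2 * (\<Sum>i\<in>UNIV. \<Sum>j\<in>UNIV. A $ i $ j)) * (norm e)\<^sup>2"
    by (simp add: sum_distrib_left sum_distrib_right mult_ac)
  finally show ?thesis .
qed

text \<open>The gradients are compared with those at the consensus point \<open>z + mean e\<close>.
  Getting there from \<open>z\<close> changes the pseudogradient by \<open>P\<close>, where strong
  monotonicity acts; the disagreement contributes \<open>Q\<close>.\<close>

lemma gradient_term_lower_bound:
  fixes J :: "'n::finite \<Rightarrow> real ^ 'n \<Rightarrow> real" and e :: "(real ^ 'n) ^ 'n"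
  assumes mono: "strongly_monotone m (pseudogradient J)"
    and lipF: "l-lipschitz_on UNIV (pseudogradient J)"
    and lipE: "l-lipschitz_on UNIV (extended_pseudogradient J)"
    and zero: "pseudogradient J z = 0"
  defines "a \<equiv> norm (mean e)" and "d \<equiv> norm (e - vec (mean e))"
  shows "m * a\<^sup>2 - 2 * l * a * d - l * d\<^sup>2 \<le> (\<Sum>i\<in>UNIV. partial_grad J i (z + e $ i) * e $ i $ i)"
proof -
  let ?F = "pseudogradient J" and ?E = "extended_pseudogradient J"
  define b where "b = mean e"
  \<comment> \<open>The own-decision entries of the deviation. Each is at most the norm of its
    block, so \<open>norm \<delta> \<le> d\<close>; the own-decision errors \<open>e $ i $ i\<close>
    form the vector \<open>b + \<delta>\<close>.\<close>
  define \<delta> where "\<delta> = (\<chi> i. (e - vec b) $ i $ i)"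
  have l: "0 \<le> l" using lipF by (rule lipschitz_on_nonneg)
  have "norm \<delta> \<le> d"
    unfolding d_def b_def[symmetric]
    by (rule norm_le_componentwise_cart) (use component_le_norm_cart[of "(e - vec b) $ _"] in \<open>simp add: \<delta>_def\<close>)
  define P where "P = ?F (z + b) - ?F z"
  define Q where "Q = ?E (vec z + e) - ?E (vec (z + b))"
  have P: "norm P \<le> l * a"
    using lipschitz_onD[OF lipF UNIV_I UNIV_I, of "z + b" z]
    by (simp add: P_def dist_norm a_def b_def)
  have Q: "norm Q \<le> l * d"
  proof -
    have eq: "vec z + e - vec (z + b) = e - vec b" by (simp add: vec_eq_iff)
    show ?thesis
      using lipschitz_onD[OF lipE UNIV_I UNIV_I, of "vec z + e" "vec (z + b)"]
      unfolding dist_norm eq Q_def d_def b_def[symmetric] .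
  qed
  have "?E (vec (z + b)) = ?F (z + b)"
    by (simp add: extended_pseudogradient_def pseudogradient_def)
  then have PQ: "?E (vec z + e) = P + Q" by (simp add: P_def Q_def zero)
  have "(\<Sum>i\<in>UNIV. partial_grad J i (z + e $ i) * e $ i $ i) = (b + \<delta>) \<bullet> ?E (vec z + e)"
    by (simp add: inner_vec_def extended_pseudogradient_def \<delta>_def mult.commute)
  also have "\<dots> = b \<bullet> P + \<delta> \<bullet> P + b \<bullet> Q + \<delta> \<bullet> Q"
    by (simp add: PQ inner_add)
  finally have eq: "(\<Sum>i\<in>UNIV. partial_grad J i (z + e $ i) * e $ i $ i)
      = b \<bullet> P + \<delta> \<bullet> P + b \<bullet> Q + \<delta> \<bullet> Q" .
  \<comment> \<open>Only the first of the four products has a favourable sign. The mixed terms cost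
    \<open>l * a * d\<close> each, and the last costs \<open>l * d\<^sup>2\<close>.\<close>
  have "m * a\<^sup>2 \<le> b \<bullet> P"
    using mono[unfolded strongly_monotone_def, rule_format, of "z + b" z]
    by (simp add: P_def a_def b_def)
  moreover have "- (d * (l * a)) \<le> \<delta> \<bullet> P"
    using Cauchy_Schwarz_ineq2[of \<delta> P] mult_mono[OF \<open>norm \<delta> \<le> d\<close> P]
    by (simp add: d_def)
  moreover have "- (a * (l * d)) \<le> b \<bullet> Q"
    using Cauchy_Schwarz_ineq2[of b Q] mult_left_mono[OF Q, of a]
    by (simp add: a_def b_def)
  moreover have "- (d * (l * d)) \<le> \<delta> \<bullet> Q"
    using Cauchy_Schwarz_ineq2[of \<delta> Q] mult_mono[OF \<open>norm \<delta> \<le> d\<close> Q]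
    by (simp add: d_def)
  ultimately show ?thesis unfolding eq by (simp add: power2_eq_square algebra_simps)
qed

section \<open>Lyapunov analysis of the equilibrium-seeking dynamics\<close>

context strongly_connected_left_eigenvector
begin

lemma trajectory_converges:
  assumes mono: "strongly_monotone m (pseudogradient J)" and m: "0 < m"
    and lipF: "l-lipschitz_on UNIV (pseudogradient J)"
    and lipE: "l-lipschitz_on UNIV (extended_pseudogradient J)"
    and gain: "1 / lambda2 * (l\<^sup>2 / m + l) < \<alpha>"
    and zero: "pseudogradient J z_star = 0"
    and traj: "is_trajectory J A \<alpha> z \<Xi>"
  shows "converges_exponentially (\<lambda>t. z t $ i) z_star"
proof -
  have l: "0 \<le> l" using lipF by (rule lipschitz_on_nonneg)
  have "0 \<le> 1 / lambda2 * (l\<^sup>2 / m + l)"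
    using lambda2_pos l m by simp
  then have \<alpha>: "0 < \<alpha>" using gain by linarith
  have "l\<^sup>2 / m + l < \<alpha> * lambda2"
    using gain lambda2_pos by (simp add: pos_divide_less_eq)
  then have "l\<^sup>2 < m * (\<alpha> * lambda2 - l)"
    using m by (simp add: field_simps)
  from binary_quadratic_form_coercive[OF m this] obtain c where c: "0 < c"
    and coercive: "\<And>a d. c * (a\<^sup>2 + d\<^sup>2) \<le> m * a\<^sup>2 - 2 * l * a * d + (\<alpha> * lambda2 - l) * d\<^sup>2"
    by blast
  obtain C where C: "0 \<le> C"
    and C_bound: "\<And>t i. 0 \<le> t \<Longrightarrow> \<bar>\<Xi> t $ i $ i - \<xi> $ i\<bar> \<le> C * exp (- lambda2 * t)"
    using left_eigenvector_estimate_converges[of \<Xi>] traj unfolding is_trajectory_def by blast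
  define e where "e t = z t - vec z_star" for t
  define q where "q t i = e t $ i \<bullet> (\<Sum>j\<in>UNIV. A $ i $ j *\<^sub>R (e t $ i - e t $ j))" for t i
  define G where "G t = (\<Sum>i\<in>UNIV. partial_grad J i (z_star + e t $ i) * e t $ i $ i)" for t
  define V where "V t = (norm (e t))\<^sup>2" for t
  define S where "S = (\<Sum>i\<in>UNIV. \<Sum>j\<in>UNIV. A $ i $ j)"
  have "0 \<le> S"
    unfolding S_def using digraph by (intro sum_nonneg) (simp add: weighted_digraph_def)
  have e': "((\<lambda>t. e t $ i) has_vector_derivative
      (- (\<alpha> * \<Xi> t $ i $ i) *\<^sub>R (\<Sum>j\<in>UNIV. A $ i $ j *\<^sub>R (e t $ i - e t $ j))
        - partial_grad J i (z_star + e t $ i) *\<^sub>R axis i 1)) (at t within {0..})"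
    if "0 \<le> t" for t i
  proof -
    have "((\<lambda>t. z t $ i - z_star) has_vector_derivative
      (- (\<alpha> * \<Xi> t $ i $ i) *\<^sub>R (\<Sum>j\<in>UNIV. A $ i $ j *\<^sub>R (z t $ i - z t $ j))
        - partial_grad J i (z t $ i) *\<^sub>R axis i 1) - 0) (at t within {0..})"
      using traj that unfolding is_trajectory_def
      by (intro has_vector_derivative_diff has_vector_derivative_const) blast
    then show ?thesis by (simp add: e_def)
  qed
  have V': "(V has_real_derivative
      - 2 * (\<alpha> * (\<Sum>i\<in>UNIV. \<Xi> t $ i $ i * q t i) + G t)) (at t within {0..})" if "0 \<le> t" for t
  proof -
    have "((\<lambda>t. e t $ i \<bullet> e t $ i) has_real_derivative
      - 2 * (\<alpha> * (\<Xi> t $ i $ i * q t i) + partial_grad J i (z_star + e t $ i) * e t $ i $ i))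
      (at t within {0..})" for i
      using bounded_bilinear.has_vector_derivative[OF bounded_bilinear_inner e'[OF that, of i] e'[OF that, of i]]
      unfolding has_real_derivative_iff_has_vector_derivative
      by (rule back_subst[where P = "\<lambda>v. (_ has_vector_derivative v) _"])
        (simp add: q_def inner_diff inner_axis inner_axis' inner_commute algebra_simps)
    then have "((\<lambda>t. \<Sum>i\<in>UNIV. e t $ i \<bullet> e t $ i) has_real_derivative
      (\<Sum>i\<in>UNIV. - 2 * (\<alpha> * (\<Xi> t $ i $ i * q t i)
         + partial_grad J i (z_star + e t $ i) * e t $ i $ i))) (at t within {0..})"
      by (intro DERIV_sum)
    moreover have "(\<lambda>t. \<Sum>i\<in>UNIV. e t $ i \<bullet> e t $ i) = V"
      by (simp add: V_def power2_norm_eq_inner inner_vec_def fun_eq_iff)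
    moreover have "(\<Sum>i\<in>UNIV. - 2 * (\<alpha> * (\<Xi> t $ i $ i * q t i)
         + partial_grad J i (z_star + e t $ i) * e t $ i $ i))
      = - 2 * (\<alpha> * (\<Sum>i\<in>UNIV. \<Xi> t $ i $ i * q t i) + G t)"
      unfolding G_def sum_distrib_left sum.distrib[symmetric] ..
    ultimately show ?thesis by simp
  qed
  \<comment> \<open>One factor 2 comes from differentiating the square, the other from
    \<open>weighted_coupling_bound\<close>.\<close>
  define K where "K = 4 * \<alpha> * C * S"
  \<comment> \<open>\<open>V\<close> is \<open>CARD('n) * a\<^sup>2 + d\<^sup>2\<close>, at most
    \<open>CARD('n)\<close> times the sum of squares that \<open>coercive\<close> controls.\<close>
  define \<kappa> where "\<kappa> = 2 * c / CARD('n)"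
  have V'_le: "- 2 * (\<alpha> * (\<Sum>i\<in>UNIV. \<Xi> t $ i $ i * q t i) + G t)
      \<le> - (\<kappa> - K * exp (- lambda2 * t)) * V t" if "0 \<le> t" for t
  proof -
    define a where "a = norm (mean (e t))"
    define d where "d = norm (e t - vec (mean (e t)))"
    \<comment> \<open>The discrepancy between the actual coupling and the ideal one weighted by
      \<open>\<xi>\<close>; only the ideal one is covered by the spectral bound.\<close>
    define E where "E = (\<Sum>i\<in>UNIV. (\<Xi> t $ i $ i - \<xi> $ i) * q t i)"
    have "\<bar>E\<bar> \<le> C * exp (- lambda2 * t) * (2 * S) * V t"
      unfolding E_def q_def S_def V_def by (intro weighted_coupling_bound digraph C_bound that)
    then have "\<alpha> * (- E) \<le> \<alpha> * (C * exp (- lambda2 * t) * (2 * S) * V t)"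
      using \<alpha> by (intro mult_left_mono) auto
    then have E: "- 2 * (\<alpha> * E) \<le> K * exp (- lambda2 * t) * V t"
      by (simp add: K_def algebra_simps)
    have "lambda2 * d\<^sup>2 \<le> (\<Sum>i\<in>UNIV. \<xi> $ i * q t i)"
      unfolding d_def q_def by (rule lambda2_le_stacked)
    also have "\<dots> = (\<Sum>i\<in>UNIV. \<Xi> t $ i $ i * q t i) - E"
      by (simp add: E_def left_diff_distrib sum_subtractf)
    finally have "\<alpha> * (lambda2 * d\<^sup>2) \<le> \<alpha> * ((\<Sum>i\<in>UNIV. \<Xi> t $ i $ i * q t i) - E)"
      using \<alpha> by simp
    moreover have "m * a\<^sup>2 - 2 * l * a * d - l * d\<^sup>2 \<le> G t"
      unfolding a_def d_def G_def by (rule gradient_term_lower_bound[OF mono lipF lipE zero])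
    ultimately have "c * (a\<^sup>2 + d\<^sup>2) \<le> \<alpha> * (\<Sum>i\<in>UNIV. \<Xi> t $ i $ i * q t i) - \<alpha> * E + G t"
      using coercive[of a d] by (simp add: algebra_simps)
    moreover have "\<kappa> * V t \<le> 2 * (c * (a\<^sup>2 + d\<^sup>2))"
    proof -
      have "V t = CARD('n) * a\<^sup>2 + d\<^sup>2"
        unfolding V_def a_def d_def by (rule norm_mean_decomposition)
      also have "\<dots> \<le> CARD('n) * (a\<^sup>2 + d\<^sup>2)"
        using card mult_right_mono[of 1 "real CARD('n)" "d\<^sup>2"] by (simp add: distrib_left)
      finally have "\<kappa> * V t \<le> \<kappa> * (CARD('n) * (a\<^sup>2 + d\<^sup>2))"
        using c by (intro mult_left_mono) (auto simp: \<kappa>_def)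
      then show ?thesis by (simp add: \<kappa>_def)
    qed
    ultimately show ?thesis using E by (simp add: algebra_simps)
  qed
  have V_bound: "V t \<le> V 0 * exp (K / lambda2) * exp (- \<kappa> * t)" if "0 \<le> t" for t
    by (rule exp_decay_of_differential_inequality[OF V' V'_le])
      (use that lambda2_pos \<alpha> C \<open>0 \<le> S\<close> in \<open>auto simp: V_def K_def\<close>)
  define B where "B = sqrt (V 0 * exp (K / lambda2))"
  have B: "0 \<le> B" by (simp add: B_def V_def)
  show ?thesis
    unfolding converges_exponentially_def
  proof (intro exI conjI allI impI)
    \<comment> \<open>\<open>B\<close> vanishes for a trajectory that starts at equilibrium, while
      the constant has to be strictly positive.\<close>
    show "0 < B + 1" using B by simp
    show "0 < \<kappa> / 2" using c by (simp add: \<kappa>_def)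
    fix t :: real assume t: "0 \<le> t"
    have "(norm (e t))\<^sup>2 \<le> V 0 * exp (K / lambda2) * exp (- \<kappa> * t)"
      using V_bound[OF t] by (simp add: V_def)
    also have "\<dots> = (B * exp (- (\<kappa> / 2) * t))\<^sup>2"
      by (simp add: B_def V_def power_mult_distrib exp_double[symmetric])
    finally have "norm (e t) \<le> B * exp (- (\<kappa> / 2) * t)"
      by (rule power2_le_imp_le) (simp add: B)
    also have "\<dots> \<le> (B + 1) * exp (- (\<kappa> / 2) * t)" by (rule mult_right_mono) auto
    finally show "norm (z t $ i - z_star) \<le> (B + 1) * exp (- (\<kappa> / 2) * t)"
      using Finite_Cartesian_Product.norm_nth_le[of "e t" i] by (simp add: e_def)
  qed
qed

end

theorem theorem2:
  fixes J :: "'n::finite \<Rightarrow> real ^ 'n \<Rightarrow> real"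
    and A :: "real ^ 'n ^ 'n"
    and l_low l_up l_F l \<alpha> :: real
    and \<xi> :: "real ^ 'n"
  assumes "CARD('n) \<ge> 2"
    and "weighted_digraph A"
    and "\<And>i. twice_continuously_differentiable (J i)"
    and "\<And>i z. strictly_convex (\<lambda>s. J i (replace z i s))"
    and "\<And>i z. radially_unbounded (\<lambda>s. J i (replace z i s))"
    and "l_low > 0" and "strongly_monotone l_low (pseudogradient J)"
    and "l_up > 0" and "l_up-lipschitz_on UNIV (pseudogradient J)"
    and "l_F > 0" and "l_F-lipschitz_on UNIV (extended_pseudogradient J)"
    and "strongly_connected_digraph A"
    and "l = max l_up l_F"
    and "\<xi> v* laplacian A = 0" and "(\<Sum>i\<in>UNIV. \<xi> $ i) = 1"
    and "\<alpha> > 1 / smallest_pos_eigenvalue (Sym (diag \<xi> ** laplacian A)) * (l\<^sup>2 / l_low + l)"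
  shows "(\<exists>!z_star. nash_equilibrium J z_star) \<and>
    (\<forall>z_star z \<Xi>. nash_equilibrium J z_star \<and> is_trajectory J A \<alpha> z \<Xi> \<longrightarrow>
       (\<forall>i. converges_exponentially (\<lambda>t. z t $ i) z_star))"
proof -
  interpret strongly_connected_left_eigenvector A \<xi>
    using assms by unfold_locales
  have nash: "nash_equilibrium J z \<longleftrightarrow> pseudogradient J z = 0" for z
    by (rule nash_equilibrium_iff_pseudogradient_zero) (use assms in blast)+
  \<comment> \<open>Since \<open>l\<close> is the maximum of the two constants, it serves both maps
    at once.\<close>
  have "l-lipschitz_on UNIV (pseudogradient J)" "l-lipschitz_on UNIV (extended_pseudogradient J)"
    using assms by (auto intro: lipschitz_on_le)
  note converges = trajectory_converges[OF assms(7) assms(6) this assms(16)]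
  show ?thesis
    unfolding nash
    using strongly_monotone_lipschitz_zero[OF assms(7) assms(9) assms(6)] converges by blast
qed

end
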